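(* Let $m\ge 2$ be an integer and $n\in\mathbb{N}$. The hierarchical system of Burgers equations $$\frac{\partial u_n}{\partial x_k}=\frac{\partial}{\partial x_1}\left(\frac{\partial}{\partial x_1}+u_n\right)^{k-1}u_n,\qquad 1<k\le m,$$ admits the solution $$u_n(x_1,\dots,x_m)=\frac{n\,H_{n-1}^{(m)}(x_1,\dots,x_m)}{H_n^{(m)}(x_1,\dots,x_m)},$$ i.e. this function satisfies all $m-1$ equations at every $(x_1,\dots,x_m)\in\mathbb{R}^m$ where $H_n^{(m)}(x_1,\dots,x_m)\neq 0$.
   Context: Here $\mathbb{N}=\{1,2,3,\dots\}$. The non-lacunary $m$-th order Hermite polynomials $H_n^{(m)}(x_1,\dots,x_m)$, $n\ge 0$, are defined recursively in $m$: for $m=2$, $$H_n^{(2)}(x_1,x_2)=H_n(x_1,x_2)=n!\sum_{r=0}^{\lfloor n/2\rfloor}\frac{x_2^r\, x_1^{n-2r}}{(n-2r)!\,r!},$$ and for $m\ge 3$, $$H_n^{(m)}(x_1,\dots,x_m)=n!\sum_{r=0}^{\lfloor n/m\rfloor}\frac{H_{n-mr}^{(m-1)}(x_1,\dots,x_{m-1})\,x_m^r}{(n-mr)!\,r!}.$$ Equivalently, $\sum_{n\ge 0}\frac{t^n}{n!}H_n^{(m)}(x_1,\dots,x_m)=\exp(x_1t+x_2t^2+\cdots+x_mt^m)$. The expression $\frac{\partial}{\partial x_1}+u_n$ denotes the differential operator $f\mapsto\frac{\partial f}{\partial x_1}+u_n f$, and powers denote composition of operators; thus $\left(\frac{\partial}{\partial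 x_1}+u_n\right)^{k-1}u_n$ is this operator applied $k-1$ times to the function $u_n$. *)

theory Defs
  imports "HOL-Analysis.Analysis"
begin

text \<open>
  A point $(x_1, \ldots, x_m)$ is represented by a function \<open>x :: nat \<Rightarrow> real\<close> of which only the
  entries \<open>x 1, \<dots>, x m\<close> matter. This lets the dimension \<open>m\<close> be a number, on which the Hermite
  polynomials are defined by recursion.
\<close>

definition hermite2 :: "nat \<Rightarrow> real \<Rightarrow> real \<Rightarrow> real" where
  "hermite2 n x1 x2 =
     fact n * (\<Sum>r\<le>n div 2. x2 ^ r * x1 ^ (n - 2 * r) / (fact (n - 2 * r) * fact r))"

text \<open>The order \<open>m\<close> is meant to be at least 2; smaller orders get the value of order 2.\<close>

fun hermite :: "nat \<Rightarrow> nat \<Rightarrow> (nat \<Rightarrow> real) \<Rightarrow> real" where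
  "hermite m n x =
     (if m \<le> 2 then hermite2 n (x 1) (x 2)
      else fact n * (\<Sum>r\<le>n div m.
             hermite (m - 1) (n - m * r) x * x m ^ r / (fact (n - m * r) * fact r)))"

declare hermite.simps [simp del]

definition pdifferentiable :: "nat \<Rightarrow> ((nat \<Rightarrow> real) \<Rightarrow> real) \<Rightarrow> (nat \<Rightarrow> real) \<Rightarrow> bool" where
  "pdifferentiable k f x \<longleftrightarrow> (\<lambda>t. f (x(k := t))) differentiable at (x k)"

definition partial :: "nat \<Rightarrow> ((nat \<Rightarrow> real) \<Rightarrow> real) \<Rightarrow> (nat \<Rightarrow> real) \<Rightarrow> real" where
  "partial k f x = deriv (\<lambda>t. f (x(k := t))) (x k)"

definition burgers_op ::
  "((nat \<Rightarrow> real) \<Rightarrow> real) \<Rightarrow> ((nat \<Rightarrow> real) \<Rightarrow> real) \<Rightarrow> (nat \<Rightarrow> real) \<Rightarrow> real" where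
  "burgers_op u f = (\<lambda>x. partial 1 f x + u x * f x)"

text \<open>
  Since \<^const>\<open>deriv\<close> is total, being a solution must say explicitly that every derivative occurring
  in the equations exists: the one on the left, and the derivative in $x_1$ of each
  $(\partial/\partial x_1 + u)^j u$ with $j \le k - 1$ (those with $j < k - 1$ occur inside
  the power, the one with $j = k - 1$ is the outer derivative).
\<close>

definition solves_burgers_hierarchy ::
  "nat \<Rightarrow> (nat \<Rightarrow> real) set \<Rightarrow> ((nat \<Rightarrow> real) \<Rightarrow> real) \<Rightarrow> bool" where
  "solves_burgers_hierarchy m D u \<longleftrightarrow>
     (\<forall>x\<in>D. \<forall>k. 1 < k \<and> k \<le> m \<longrightarrow>
        pdifferentiable k u x \<and>
        (\<forall>j\<le>k - 1. pdifferentiable 1 ((burgers_op u ^^ j) u) x) \<and>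
        partial k u x = partial 1 ((burgers_op u ^^ (k - 1)) u) x)"

end

theory Submission
  imports Defs
begin

text \<open>
  The proof is the Cole--Hopf substitution. With \<open>h\<^sub>i = H\<^sub>i / i!\<close> (and \<open>h\<^sub>i = 0\<close> for \<open>i < 0\<close>), the
  coefficients of the generating function, one has \<open>\<partial>h\<^sub>i/\<partial>x\<^sub>k = h\<^bsub>i-k\<^esub>\<close>, so \<open>h\<^sub>n\<close> satisfies
  \<open>\<partial>h\<^sub>n/\<partial>x\<^sub>k = \<partial>\<^sup>k h\<^sub>n/\<partial>x\<^sub>1\<^sup>k\<close> and \<open>u\<^sub>n = h\<^bsub>n-1\<^esub> / h\<^sub>n\<close> is its logarithmic derivative. Hence
  \<open>\<partial>/\<partial>x\<^sub>1 + u\<^sub>n\<close> is the conjugate of \<open>\<partial>/\<partial>x\<^sub>1\<close> by \<open>h\<^sub>n\<close>, which gives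
  \<open>(\<partial>/\<partial>x\<^sub>1 + u\<^sub>n)\<^sup>j u\<^sub>n = h\<^bsub>n-j-1\<^esub> / h\<^sub>n\<close>, and both sides of the equation equal
  \<open>(h\<^bsub>n-k-1\<^esub> h\<^sub>n - h\<^bsub>n-1\<^esub> h\<^bsub>n-k\<^esub>) / h\<^sub>n\<^sup>2\<close>.
\<close>

text \<open>
  The coefficient of \<open>t\<^sup>i\<close> in \<open>exp (x\<^sub>1 t + \<dots> + x\<^sub>m t\<^sup>m)\<close>. Integer indices, with value 0 at negative
  ones, let the derivative rule hold without case distinction, and starting at \<open>m = 0\<close> makes the
  recursion uniform.
\<close>
primrec hermite_coeff :: "nat \<Rightarrow> int \<Rightarrow> (nat \<Rightarrow> real) \<Rightarrow> real" where
  "hermite_coeff 0 i x = of_bool (i = 0)"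
| "hermite_coeff (Suc m) i x =
     (\<Sum>r\<le>nat i. hermite_coeff m (i - int (Suc m * r)) x * x (Suc m) ^ r / fact r)"

lemma hermite_coeff_neg: "i < 0 \<Longrightarrow> hermite_coeff m i x = 0"
  by (induction m arbitrary: i) auto

text \<open>The hypothesis amounts to i < (m + 1)(N + 1), so every term beyond \<open>N\<close> has
  a negative index and vanishes. This freedom in the range yields the bound
  \<open>n div Suc m\<close> of \<open>hermite\<close> and lets a sum and its derivative be written
  over suitable ranges.\<close>

lemma hermite_coeff_Suc_upto:
  assumes "i \<le> int (Suc m * N) + int m"
  shows "hermite_coeff (Suc m) i x =
    (\<Sum>r\<le>N. hermite_coeff m (i - int (Suc m * r)) x * x (Suc m) ^ r / fact r)"
proof (cases "i < 0")
  case True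
  have "i - int (Suc m * r) < 0" for r
    using True by (smt (verit) of_nat_0_le_iff)
  then show ?thesis
    unfolding hermite_coeff_neg[OF True] by (simp only: hermite_coeff_neg) simp
next
  case False
  have vanish: "i - int (Suc m * r) < 0" if "\<not> (r \<le> nat i \<and> r \<le> N)" for r
  proof (cases "r \<le> N")
    case True
    then have "i < int r"
      using that False by linarith
    also have "int r \<le> int (Suc m * r)"
      by (simp only: of_nat_le_iff) simp
    finally show ?thesis
      by simp
  next
    case False
    then have "Suc m * Suc N \<le> Suc m * r"
      by (intro mult_le_mono2) simp
    then have "int (Suc m * N) + int (Suc m) \<le> int (Suc m * r)"
      by (simp only: of_nat_add [symmetric] of_nat_le_iff) simp
    with assms show ?thesis
      by linarith
  qed
  let ?f = "\<lambda>r. hermite_coeff m (i - int (Suc m * r)) x * x (Suc m) ^ r / fact r"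
  have "sum ?f {..nat i} = sum ?f ({..nat i} \<inter> {..N})"
    by (rule sum.mono_neutral_right) (use vanish in \<open>auto simp: hermite_coeff_neg\<close>)
  also have "\<dots> = sum ?f {..N}"
    by (rule sum.mono_neutral_left) (use vanish in \<open>auto simp: hermite_coeff_neg\<close>)
  finally show ?thesis
    by simp
qed

lemma hermite_coeff_Suc_div:
  "hermite_coeff (Suc m) (int n) x =
    (\<Sum>r\<le>n div Suc m. hermite_coeff m (int n - int (Suc m * r)) x * x (Suc m) ^ r / fact r)"
proof (rule hermite_coeff_Suc_upto)
  have "n = Suc m * (n div Suc m) + n mod Suc m" "n mod Suc m \<le> m"
    by (simp_all only: mult_div_mod_eq) (simp add: less_Suc_eq_le [symmetric])
  then show "int n \<le> int (Suc m * (n div Suc m)) + int m"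
    by linarith
qed

lemma hermite_eq_hermite_coeff:
  assumes "m \<ge> 2"
  shows "hermite m n x = fact n * hermite_coeff m (int n) x"
  using assms
proof (induction m arbitrary: n rule: dec_induct)
  case base
  \<comment> \<open>These are the coefficients of exp(x_1 t); at order 0 only the term r = k
    survives.\<close>
  have order1: "hermite_coeff 1 (int k) x = x 1 ^ k / fact k" for k
  proof -
    have "hermite_coeff 1 (int k) x = (\<Sum>r\<le>k. if r = k then x 1 ^ r / fact r else 0)"
      unfolding One_nat_def hermite_coeff.simps by (rule sum.cong) auto
    then show ?thesis
      by simp
  qed
  have "hermite_coeff 2 (int n) x
      = (\<Sum>r\<le>n div 2. hermite_coeff 1 (int n - int (2 * r)) x * x 2 ^ r / fact r)"
    using hermite_coeff_Suc_div[of 1 n x] by (simp only: Suc_1)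
  also have "\<dots> = (\<Sum>r\<le>n div 2. x 2 ^ r * x 1 ^ (n - 2 * r) / (fact (n - 2 * r) * fact r))"
  proof (rule sum.cong)
    fix r assume "r \<in> {..n div 2}"
    then have "int n - int (2 * r) = int (n - 2 * r)"
      by auto
    then show "hermite_coeff 1 (int n - int (2 * r)) x * x 2 ^ r / fact r =
        x 2 ^ r * x 1 ^ (n - 2 * r) / (fact (n - 2 * r) * fact r)"
      by (simp only: order1) (simp add: field_simps)
  qed simp
  finally show ?case
    by (simp add: hermite.simps hermite2_def)
next
  case (step m)
  have "hermite_coeff (Suc m) (int n) x =
      (\<Sum>r\<le>n div Suc m. hermite_coeff m (int n - int (Suc m * r)) x * x (Suc m) ^ r / fact r)"
    by (rule hermite_coeff_Suc_div)
  also have "\<dots> = (\<Sum>r\<le>n div Suc m.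
      hermite m (n - Suc m * r) x * x (Suc m) ^ r / (fact (n - Suc m * r) * fact r))"
  proof (rule sum.cong)
    fix r assume "r \<in> {..n div Suc m}"
    then have "r * Suc m \<le> n"
      by (simp only: atMost_iff less_eq_div_iff_mult_less_eq zero_less_Suc)
    then have "int n - int (Suc m * r) = int (n - Suc m * r)"
      by (simp only: mult.commute of_nat_diff)
    then show "hermite_coeff m (int n - int (Suc m * r)) x * x (Suc m) ^ r / fact r =
        hermite m (n - Suc m * r) x * x (Suc m) ^ r / (fact (n - Suc m * r) * fact r)"
      by (simp only: step.IH) simp
  qed simp
  finally show ?case
    using step.hyps by (subst hermite.simps) simp
qed

lemma hermite_coeff_upd: "m < k \<Longrightarrow> hermite_coeff m i (x(k := t)) = hermite_coeff m i x"
  by (induction m arbitrary: i) auto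

text \<open>Differentiating the generating function in x_k multiplies it by t^k, which shifts the
  coefficients by k. On the coefficients: for k = m + 1 the explicit powers are differentiated, for
  smaller k the induction hypothesis applies termwise.\<close>

lemma hermite_coeff_has_derivative:
  assumes "1 \<le> k" "k \<le> m"
  shows "((\<lambda>t. hermite_coeff m i (x(k := t))) has_real_derivative
    hermite_coeff m (i - int k) (x(k := s))) (at s)"
  using assms(2)
proof (induction m arbitrary: i)
  case 0
  with assms(1) show ?case by simp
next
  case (Suc m)
  \<comment> \<open>The range \<open>Suc N\<close> leaves a spare term: for k = m + 1 the term r = 0
    has derivative zero, and after the shift r to r + 1 the range \<open>N\<close> still suffices
    for the index i - (m + 1).\<close>
  define N where "N = nat i"
  have le: "i \<le> int (Suc m * Suc N) + int m" "i - int k \<le> int (Suc m * Suc N) + int m"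
    "i - int (Suc m) \<le> int (Suc m * N) + int m"
    unfolding N_def by (auto simp: algebra_simps)
  show ?case
  proof (cases "k = Suc m")
    case True
    have "((\<lambda>t. \<Sum>r\<le>Suc N. hermite_coeff m (i - int (Suc m * r)) x * t ^ r / fact r)
       has_real_derivative
       (\<Sum>r\<le>Suc N. hermite_coeff m (i - int (Suc m * r)) x * (real r * s ^ (r - 1)) / fact r)) (at s)"
      by (rule DERIV_sum) (auto intro!: derivative_eq_intros)
    also have "(\<Sum>r\<le>Suc N. hermite_coeff m (i - int (Suc m * r)) x * (real r * s ^ (r - 1)) / fact r)
        = (\<Sum>r\<le>N. hermite_coeff m (i - int (Suc m) - int (Suc m * r)) x * s ^ r / fact r)"
    proof -
      have "real (Suc r) * s ^ (Suc r - 1) / fact (Suc r) = s ^ r / fact r" for r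
        by (simp del: of_nat_Suc)
      moreover have "i - int (Suc m * Suc r) = i - int (Suc m) - int (Suc m * r)" for r
        by (simp add: algebra_simps)
      ultimately show ?thesis
        by (simp only: sum.atMost_Suc_shift times_divide_eq_right [symmetric])
    qed
    also have "\<dots> = hermite_coeff (Suc m) (i - int (Suc m)) (x(Suc m := s))"
      by (simp only: hermite_coeff_Suc_upto[OF le(3)] hermite_coeff_upd lessI fun_upd_same)
    finally show ?thesis
      by (simp only: True hermite_coeff_Suc_upto[OF le(1)] hermite_coeff_upd lessI fun_upd_same)
  next
    case False
    with Suc have "k \<le> m"
      by simp
    have "((\<lambda>t. \<Sum>r\<le>Suc N. hermite_coeff m (i - int (Suc m * r)) (x(k := t)) * x (Suc m) ^ r / fact r)
       has_real_derivative
       (\<Sum>r\<le>Suc N. hermite_coeff m (i - int (Suc m * r) - int k) (x(k := s)) * x (Suc m) ^ r / fact r))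
       (at s)"
      by (intro DERIV_sum DERIV_cdivide DERIV_cmult_right Suc.IH \<open>k \<le> m\<close>)
    also have "(\<lambda>r. i - int (Suc m * r) - int k) = (\<lambda>r. i - int k - int (Suc m * r))"
      by (simp add: algebra_simps)
    finally show ?thesis
      using False by (simp only: hermite_coeff_Suc_upto[OF le(1)] hermite_coeff_Suc_upto[OF le(2)]
        fun_upd_other not_sym)
  qed
qed

lemma hermite_coeff_ratio_has_derivative:
  assumes "1 \<le> k" "k \<le> m" and nz: "hermite_coeff m n x \<noteq> 0"
  shows "((\<lambda>t. hermite_coeff m i (x(k := t)) / hermite_coeff m n (x(k := t))) has_real_derivative
    (hermite_coeff m (i - int k) x * hermite_coeff m n x
     - hermite_coeff m i x * hermite_coeff m (n - int k) x) / (hermite_coeff m n x)\<^sup>2) (at (x k))"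
  using DERIV_divide[OF hermite_coeff_has_derivative[OF assms(1,2), of i x "x k"]
      hermite_coeff_has_derivative[OF assms(1,2), of n x "x k"]] nz
  by (simp add: power2_eq_square)

text \<open>A quotient formula known only off the zero set can be differentiated there because, by
  continuity, it holds near the point.\<close>

lemma eventually_hermite_coeff_nonzero:
  assumes "1 \<le> k" "k \<le> m" and nz: "hermite_coeff m n x \<noteq> 0"
  shows "\<forall>\<^sub>F t in nhds (x k). hermite_coeff m n (x(k := t)) \<noteq> 0"
proof -
  have "isCont (\<lambda>t. hermite_coeff m n (x(k := t))) (x k)"
    using DERIV_isCont[OF hermite_coeff_has_derivative[OF assms(1,2)]] .
  then have "((\<lambda>t. hermite_coeff m n (x(k := t))) \<longlongrightarrow> hermite_coeff m n x) (nhds (x k))"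
    by (simp add: continuous_at tendsto_nhds_iff)
  then show ?thesis
    using nz by (rule tendsto_imp_eventually_ne)
qed

context
  fixes m :: nat and n :: int and u :: "(nat \<Rightarrow> real) \<Rightarrow> real"
  defines "u \<equiv> \<lambda>x. hermite_coeff m (n - 1) x / hermite_coeff m n x"
  assumes m: "1 \<le> m"
begin

text \<open>The closed form of the power is a hypothesis so that this serves both inside the
  induction that proves it and afterwards.\<close>

lemma burgers_op_power_has_derivative:
  assumes "hermite_coeff m n x \<noteq> 0"
    and power: "\<And>y. hermite_coeff m n y \<noteq> 0 \<Longrightarrow>
      (burgers_op u ^^ j) u y = hermite_coeff m (n - int j - 1) y / hermite_coeff m n y"
  shows "((\<lambda>t. (burgers_op u ^^ j) u (x(1 := t))) has_real_derivative
    (hermite_coeff m (n - int j - 2) x * hermite_coeff m n x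
     - hermite_coeff m (n - int j - 1) x * hermite_coeff m (n - 1) x) / (hermite_coeff m n x)\<^sup>2) (at (x 1))"
proof -
  have "\<forall>\<^sub>F t in nhds (x 1). (burgers_op u ^^ j) u (x(1 := t)) =
      hermite_coeff m (n - int j - 1) (x(1 := t)) / hermite_coeff m n (x(1 := t))"
    by (rule eventually_mono[OF eventually_hermite_coeff_nonzero[OF order.refl m assms(1)]]) (rule power)
  then show ?thesis
    using hermite_coeff_ratio_has_derivative[OF order.refl m assms(1), of "n - int j - 1"]
    by (subst DERIV_cong_ev[OF refl _ refl]) simp_all
qed

lemma burgers_op_power:
  "hermite_coeff m n x \<noteq> 0 \<Longrightarrow>
    (burgers_op u ^^ j) u x = hermite_coeff m (n - int j - 1) x / hermite_coeff m n x"
proof (induction j arbitrary: x)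
  case 0
  then show ?case by (simp add: u_def)
next
  case (Suc j)
  have "partial 1 ((burgers_op u ^^ j) u) x =
    (hermite_coeff m (n - int j - 2) x * hermite_coeff m n x
     - hermite_coeff m (n - int j - 1) x * hermite_coeff m (n - 1) x) / (hermite_coeff m n x)\<^sup>2"
    unfolding partial_def
    by (rule DERIV_imp_deriv[OF burgers_op_power_has_derivative[OF Suc.prems Suc.IH]])
  then have "(burgers_op u ^^ Suc j) u x =
    (hermite_coeff m (n - int j - 2) x * hermite_coeff m n x
     - hermite_coeff m (n - int j - 1) x * hermite_coeff m (n - 1) x) / (hermite_coeff m n x)\<^sup>2
     + u x * (hermite_coeff m (n - int j - 1) x / hermite_coeff m n x)"
    by (simp only: funpow.simps comp_apply burgers_op_def[of u "(burgers_op u ^^ j) u"]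
      Suc.IH[OF Suc.prems])
  \<comment> \<open>The product with u cancels the second term of the quotient rule.\<close>
  also have "\<dots> = hermite_coeff m (n - int j - 2) x / hermite_coeff m n x"
    using Suc.prems by (simp add: u_def field_simps power2_eq_square)
  finally show ?case
    by (simp add: algebra_simps)
qed

lemma solves_burgers_hierarchy_hermite_coeff:
  "solves_burgers_hierarchy m {x. hermite_coeff m n x \<noteq> 0} u"
  unfolding solves_burgers_hierarchy_def
proof (intro ballI allI impI)
  fix x k
  assume "x \<in> {x. hermite_coeff m n x \<noteq> 0}" and k: "1 < k \<and> k \<le> m"
  then have x: "hermite_coeff m n x \<noteq> 0"
    by simp
  have dk: "((\<lambda>t. u (x(k := t))) has_real_derivative
    (hermite_coeff m (n - 1 - int k) x * hermite_coeff m n x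
     - hermite_coeff m (n - 1) x * hermite_coeff m (n - int k) x) / (hermite_coeff m n x)\<^sup>2) (at (x k))"
    unfolding u_def by (rule hermite_coeff_ratio_has_derivative) (use k x in auto)
  have d1: "((\<lambda>t. (burgers_op u ^^ j) u (x(1 := t))) has_real_derivative
    (hermite_coeff m (n - int j - 2) x * hermite_coeff m n x
     - hermite_coeff m (n - int j - 1) x * hermite_coeff m (n - 1) x) / (hermite_coeff m n x)\<^sup>2) (at (x 1))"
    for j
    using x burgers_op_power by (rule burgers_op_power_has_derivative)
  \<comment> \<open>At j = k - 1 the two numerators agree up to the order of factors.\<close>
  have index: "n - int (k - 1) - 2 = n - 1 - int k" "n - int (k - 1) - 1 = n - int k"
    using k by auto
  have "partial k u x = partial 1 ((burgers_op u ^^ (k - 1)) u) x"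
    unfolding partial_def DERIV_imp_deriv[OF dk] DERIV_imp_deriv[OF d1[of "k - 1"]] index
    by (simp only: mult.commute)
  then show "pdifferentiable k u x \<and>
      (\<forall>j\<le>k - 1. pdifferentiable 1 ((burgers_op u ^^ j) u) x) \<and>
      partial k u x = partial 1 ((burgers_op u ^^ (k - 1)) u) x"
    using dk d1 unfolding pdifferentiable_def real_differentiable_def by blast
qed

end

theorem corollary2p2:
  fixes m n :: nat
  assumes "m \<ge> 2" and "n \<ge> 1"
  shows "solves_burgers_hierarchy m {x. hermite m n x \<noteq> 0}
           (\<lambda>x. real n * hermite m (n - 1) x / hermite m n x)"
proof -
  have "real n * hermite m (n - 1) x / hermite m n x
      = hermite_coeff m (int n - 1) x / hermite_coeff m (int n) x" for x
  proof -
    \<comment> \<open>Since n is positive, the truncated \<open>n - 1\<close> is the integer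
      predecessor, and the factor n absorbs the quotient of factorials.\<close>
    have "real n * fact (n - 1) = fact n" "int (n - 1) = int n - 1"
      using assms(2) by (simp_all add: fact_reduce)
    then show ?thesis
      using assms(1) by (simp add: hermite_eq_hermite_coeff mult.assoc [symmetric])
  qed
  moreover have "hermite m n x \<noteq> 0 \<longleftrightarrow> hermite_coeff m (int n) x \<noteq> 0" for x
    using assms(1) by (simp add: hermite_eq_hermite_coeff)
  ultimately show ?thesis
    using solves_burgers_hierarchy_hermite_coeff[of m "int n"] assms(1) by simp
qed

end
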